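(* Let $t=0$, $0<q<1$, $N\ge1$, $a_1,\dots,a_N>0$. A fundamental nearest neighbor `dynamics' on interlacing arrays of depth $N$ (i.e. one of $\mathsf{PB}$, $\mathsf{RSK}[\boldsymbol h]$, $\mathsf R[\boldsymbol h]$, $\mathsf L[\boldsymbol h]$) is an honest Markov process (i.e. has nonnegative jump rates and probabilities of triggered moves) if and only if it is one of the following: - the push-block dynamics $\mathsf{PB}$; - the RSK-type dynamics $\mathsf{RSK}[\boldsymbol h]$ with $\boldsymbol h=(1,1,\dots,1)$ ($N$ ones); - the right-pushing dynamics $\mathsf R[\boldsymbol h]$ with $\boldsymbol h=(1,\dots,1)$ ($N-1$ ones). (For $N=1$ all fundamental `dynamics' coincide.)
   Context: **Signatures.** $\mathbb{GT}_k=\{\lambda\in\mathbb Z^k:\lambda_1\ge\dots\ge\lambda_k\}$. For $\bar\nu\in\mathbb{GT}_{k-1},\lambda\in\mathbb{GT}_k$, $\bar\nu\prec\lambda$ means $\lambda_{i+1}\le\bar\nu_i\le\lambda_i$ for $1\le i\le k-1$. $\mathrm e_j$, $\bar{\mathrm e}_i$ are standard basis vectors of $\mathbb Z^k$, $\mathbb Z^{k-1}$. An interlacing array of depth $N$ is $\lambda^{(1)}\prec\dots\prec\lambda^{(N)}$, $\lambda^{(k)}\in\mathbb{GT}_k$. For $\bar\nu\prec\lambda$ put $\mathscr F=\{j\in\{1,\dots,k\}:\lambda_j<\bar\nu_{j-1}\}$ ($\bar\nu_0=+\infty$) and $\xi(i)=\max\{j\le i:j\in\mathscr F\}$. **Quantities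 at $t=0$.** For $k\ge2$, $\bar\nu\prec\lambda$: $$T_i=\frac{(1-q^{\bar\nu_i-\lambda_{i+1}})(1-q^{\bar\nu_{i-1}-\bar\nu_i+1})}{1-q^{\lambda_i-\bar\nu_i+1}}\ (1\le i\le k-1),\qquad S_j=\frac{(1-q^{\bar\nu_{j-1}-\lambda_j})(1-q^{\lambda_j-\lambda_{j+1}+1})}{1-q^{\lambda_j-\bar\nu_j+1}}\ (1\le j\le k),$$ where any factor involving a nonexistent coordinate ($\bar\nu_0$, $\bar\nu_k$, $\lambda_{k+1}$) is replaced by $1$. **`Dynamics'.** A `dynamics' is described by rates of independent jumps $W_k(\lambda,\nu|\bar\nu)$ (the rate at which level $k$ jumps from $\lambda$ to $\nu$ when level $k-1$ is at $\bar\nu$) and probabilities of triggered moves $V_k(\lambda,\nu|\bar\lambda,\bar\nu)$ (the probability that a move $\bar\lambda\to\bar\nu$ at level $k-1$ forces $\lambda\to\nu$ at level $k$), $k=1,\dots,N$. At level $1$, $W_1(\lambda,\lambda+\mathrm e_1)=a_1$. If $\bar\nu\not\prec\lambda$, $\bar\nu-\bar{\mathrm e}_j\prec\lambda$, $\bar\nu\prec\lambda+\mathrm e_j$, then $V_k(\lambda,\lambda+\mathrm e_j|\bar\nu-\bar{\mathrm e}_j,\bar\nu)=1$ in all `dynamics'. For $\bar\nu\prec\lambda$, $m\in\mathscr F$, $j+1\in\mathscr F$, on the slice of levels $k-1,k$ ($k\ge2$): - $\mathsf{PB}$: $V_k(\lambda,\lambda+\mathrm e_m|\bar\nu-\bar{\mathrm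 e}_j,\bar\nu)=0$, $W_k(\lambda,\lambda+\mathrm e_m|\bar\nu)=a_kS_m$. - $\mathsf{RSK}(h)$, $1\le h\le k$: $V_k(\lambda,\lambda+\mathrm e_m|\bar\nu-\bar{\mathrm e}_j,\bar\nu)=r_j1_{m=\xi(j)}+(1-r_j)1_{m=j+1}$, $r_j=T_j^{-1}(S_1+\dots+S_j-T_1-\dots-T_{j-1}-1_{h\le j})$; $W_k(\lambda,\lambda+\mathrm e_m|\bar\nu)=a_k1_{\xi(h)=m}$. - $\mathsf R(h)$, $1\le h\le k-1$: $V_k(\lambda,\lambda+\mathrm e_m|\bar\nu-\bar{\mathrm e}_j,\bar\nu)=1_{j=h}1_{m=\xi(h)}$, $W_k(\lambda,\lambda+\mathrm e_m|\bar\nu)=a_k(S_m-1_{m=\xi(h)}T_h)$. - $\mathsf L(h)$, $1\le h\le k-1$: $V_k(\lambda,\lambda+\mathrm e_m|\bar\nu-\bar{\mathrm e}_j,\bar\nu)=1_{j=h}1_{m=h+1}$, $W_k(\lambda,\lambda+\mathrm e_m|\bar\nu)=a_k(S_m-1_{m=h+1}T_h)$. In all cases the remaining probability $1-\sum_mV_k(\lambda,\lambda+\mathrm e_m|\bar\nu-\bar{\mathrm e}_j,\bar\nu)$ is $V_k(\lambda,\lambda|\bar\nu-\bar{\mathrm e}_j,\bar\nu)$. For $\boldsymbol h=(h^{(1)},\dots,h^{(N)})$, $1\le h^{(k)}\le k$, $\mathsf{RSK}[\boldsymbol h]$ uses $\mathsf{RSK}(h^{(k)})$ on the slice of levels $k-1,k$;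 for $\boldsymbol h=(h^{(1)},\dots,h^{(N-1)})$, $1\le h^{(k)}\le k$, $\mathsf R[\boldsymbol h]$ and $\mathsf L[\boldsymbol h]$ use $\mathsf R(h^{(k-1)})$ and $\mathsf L(h^{(k-1)})$ there, $k=2,\dots,N$. **Honest Markov process** means: for all $k$ and all $\bar\nu\prec\lambda$, all numbers $W_k(\lambda,\lambda+\mathrm e_m|\bar\nu)$ ($m\in\mathscr F$) and $V_k(\lambda,\nu|\bar\nu-\bar{\mathrm e}_j,\bar\nu)$ ($j+1\in\mathscr F$) are nonnegative. *)

theory Defs
  imports Complex_Main
begin

section \<open>Signatures and interlacing\<close>

text \<open>
  A signature \<open>\<lambda>\<^sub>1 \<ge> \<dots> \<ge> \<lambda>\<^sub>k\<close> is a function on the naturals whose coordinates are \<open>1, \<dots>, k\<close>;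
  all other arguments are sent to \<open>0\<close>, so that equality of functions is equality of signatures.
  In particular \<open>GT 0\<close> has exactly one element.
\<close>

type_synonym signature = "nat \<Rightarrow> int"

definition GT :: "nat \<Rightarrow> signature set" where
  "GT k = {lam. (\<forall>i\<in>{1..<k}. lam (i + 1) \<le> lam i) \<and> (\<forall>i. i \<notin> {1..k} \<longrightarrow> lam i = 0)}"

definition interlaces :: "nat \<Rightarrow> signature \<Rightarrow> signature \<Rightarrow> bool" where
  "interlaces k nub lam \<longleftrightarrow>
     nub \<in> GT (k - 1) \<and> lam \<in> GT k \<and> (\<forall>i\<in>{1..k - 1}. lam (i + 1) \<le> nub i \<and> nub i \<le> lam i)"

definition add_e :: "signature \<Rightarrow> nat \<Rightarrow> signature" where
  "add_e lam j = lam(j := lam j + 1)"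

definition sub_e :: "signature \<Rightarrow> nat \<Rightarrow> signature" where
  "sub_e lam j = lam(j := lam j - 1)"

text \<open>The free coordinates; the disjunct \<open>j = 1\<close> is the convention that coordinate \<open>0\<close> of
  \<open>nub\<close> is infinite.\<close>

definition free :: "nat \<Rightarrow> signature \<Rightarrow> signature \<Rightarrow> nat set" where
  "free k nub lam = {j \<in> {1..k}. j = 1 \<or> lam j < nub (j - 1)}"

definition xi :: "nat \<Rightarrow> signature \<Rightarrow> signature \<Rightarrow> nat \<Rightarrow> nat" where
  "xi k nub lam i = Max {j \<in> free k nub lam. j \<le> i}"


section \<open>The quantities \<open>T\<^sub>i\<close> and \<open>S\<^sub>j\<close> at \<open>t = 0\<close>\<close>

text \<open>Factors, in numerators and denominators, that involve a coordinate
  \<open>0\<close> or \<open>k\<close> of \<open>nub\<close>, or \<open>k + 1\<close> of \<open>lam\<close>, are \<open>1\<close>.\<close>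

definition T_coef :: "real \<Rightarrow> nat \<Rightarrow> signature \<Rightarrow> signature \<Rightarrow> nat \<Rightarrow> real" where
  "T_coef q k nub lam i =
     (1 - q powi (nub i - lam (i + 1))) *
     (if i = 1 then 1 else 1 - q powi (nub (i - 1) - nub i + 1)) /
     (1 - q powi (lam i - nub i + 1))"

definition S_coef :: "real \<Rightarrow> nat \<Rightarrow> signature \<Rightarrow> signature \<Rightarrow> nat \<Rightarrow> real" where
  "S_coef q k nub lam j =
     (if j = 1 then 1 else 1 - q powi (nub (j - 1) - lam j)) *
     (if j = k then 1 else 1 - q powi (lam j - lam (j + 1) + 1)) /
     (if j = k then 1 else 1 - q powi (lam j - nub j + 1))"

definition r_coef :: "real \<Rightarrow> nat \<Rightarrow> nat \<Rightarrow> signature \<Rightarrow> signature \<Rightarrow> nat \<Rightarrow> real" where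
  "r_coef q k h nub lam j =
     ((\<Sum>i\<in>{1..j}. S_coef q k nub lam i) - (\<Sum>i\<in>{1..<j}. T_coef q k nub lam i) - of_bool (h \<le> j)) /
     T_coef q k nub lam j"


section \<open>The fundamental nearest neighbor dynamics\<close>

text \<open>The parameter type is \<open>nat\<close> (the number \<open>h\<close>) for a rule on one slice of levels \<open>k - 1, k\<close>, and
  \<open>nat list\<close> (the vector \<open>h\<close>) for dynamics on all levels.\<close>

datatype 'h fundamental = PB | RSK 'h | R 'h | L 'h

fun slice_W ::
  "real \<Rightarrow> real \<Rightarrow> nat fundamental \<Rightarrow> nat \<Rightarrow> signature \<Rightarrow> signature \<Rightarrow> nat \<Rightarrow> real" where
  "slice_W q a PB k nub lam m = a * S_coef q k nub lam m"
| "slice_W q a (RSK h) k nub lam m = a * of_bool (xi k nub lam h = m)"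
| "slice_W q a (R h) k nub lam m =
     a * (S_coef q k nub lam m - of_bool (m = xi k nub lam h) * T_coef q k nub lam h)"
| "slice_W q a (L h) k nub lam m =
     a * (S_coef q k nub lam m - of_bool (m = h + 1) * T_coef q k nub lam h)"

text \<open>The probability that the move \<open>sub_e nub j \<rightarrow> nub\<close> forces \<open>lam \<rightarrow> add_e lam m\<close>.\<close>

fun slice_V ::
  "real \<Rightarrow> nat fundamental \<Rightarrow> nat \<Rightarrow> signature \<Rightarrow> signature \<Rightarrow> nat \<Rightarrow> nat \<Rightarrow> real" where
  "slice_V q PB k nub lam j m = 0"
| "slice_V q (RSK h) k nub lam j m =
     r_coef q k h nub lam j * of_bool (m = xi k nub lam j) +
     (1 - r_coef q k h nub lam j) * of_bool (m = j + 1)"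
| "slice_V q (R h) k nub lam j m = of_bool (j = h) * of_bool (m = xi k nub lam h)"
| "slice_V q (L h) k nub lam j m = of_bool (j = h) * of_bool (m = h + 1)"

text \<open>The entry of index \<open>i\<close> of a vector \<open>h\<close> is \<open>h ! (i - 1)\<close>.\<close>

fun is_fundamental :: "nat \<Rightarrow> nat list fundamental \<Rightarrow> bool" where
  "is_fundamental N PB \<longleftrightarrow> True"
| "is_fundamental N (RSK h) \<longleftrightarrow>
     length h = N \<and> (\<forall>k\<in>{1..N}. 1 \<le> h ! (k - 1) \<and> h ! (k - 1) \<le> k)"
| "is_fundamental N (R h) \<longleftrightarrow>
     length h = N - 1 \<and> (\<forall>k\<in>{1..N - 1}. 1 \<le> h ! (k - 1) \<and> h ! (k - 1) \<le> k)"
| "is_fundamental N (L h) \<longleftrightarrow>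
     length h = N - 1 \<and> (\<forall>k\<in>{1..N - 1}. 1 \<le> h ! (k - 1) \<and> h ! (k - 1) \<le> k)"

text \<open>The rule used on the slice of levels \<open>k - 1, k\<close>, for \<open>k \<ge> 2\<close>: \<open>RSK\<close> uses entry \<open>k\<close>,
  but \<open>R\<close> and \<open>L\<close> use entry \<open>k - 1\<close>.\<close>

fun slice :: "nat list fundamental \<Rightarrow> nat \<Rightarrow> nat fundamental" where
  "slice PB k = PB"
| "slice (RSK h) k = RSK (h ! (k - 1))"
| "slice (R h) k = R (h ! (k - 2))"
| "slice (L h) k = L (h ! (k - 2))"

text \<open>
  The formal data of a dynamics: \<open>jump_rate D k lam nu nub\<close> is \<open>W\<^sub>k(lam, nu | nub)\<close> and
  \<open>push_prob D k lam nu lamb nub\<close> is \<open>V\<^sub>k(lam, nu | lamb, nub)\<close>. No sign condition is built in.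
\<close>

record dynamics =
  jump_rate :: "nat \<Rightarrow> signature \<Rightarrow> signature \<Rightarrow> signature \<Rightarrow> real"
  push_prob :: "nat \<Rightarrow> signature \<Rightarrow> signature \<Rightarrow> signature \<Rightarrow> signature \<Rightarrow> real"

text \<open>
  In the sums below at most one summand is nonzero: a sum only selects the \<open>m\<close> with
  \<open>nu = add_e lam m\<close>, respectively the \<open>j\<close> with \<open>lamb = sub_e nub j\<close>. Arguments which do not describe a
  jump or a triggered move at one of the levels \<open>1, \<dots>, N\<close> get the value \<open>0\<close>, so two dynamics of
  depth \<open>N\<close> are equal iff they have the same rates and probabilities.
\<close>

definition W_of :: "real \<Rightarrow> (nat \<Rightarrow> real) \<Rightarrow> nat \<Rightarrow> nat list fundamental \<Rightarrow>
    nat \<Rightarrow> signature \<Rightarrow> signature \<Rightarrow> signature \<Rightarrow> real" where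
  "W_of q a N d k lam nu nub =
     (if k \<in> {1..N} \<and> interlaces k nub lam
      then \<Sum>m\<in>free k nub lam.
             if nu = add_e lam m
             then (if k = 1 then a 1 else slice_W q (a k) (slice d k) k nub lam m)
             else 0
      else 0)"

text \<open>If \<open>nub\<close> still interlaces with \<open>lam\<close>, the move is governed by the slice rule, and the remaining
  probability is that of \<open>lam\<close> staying put. Otherwise the move \<open>sub_e nub j \<rightarrow> nub\<close> forces
  \<open>lam \<rightarrow> add_e lam j\<close> in all dynamics.\<close>

definition V_of :: "real \<Rightarrow> nat \<Rightarrow> nat list fundamental \<Rightarrow>
    nat \<Rightarrow> signature \<Rightarrow> signature \<Rightarrow> signature \<Rightarrow> signature \<Rightarrow> real" where
  "V_of q N d k lam nu lamb nub =
     (if k \<in> {2..N} \<and> interlaces k lamb lam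
      then \<Sum>j\<in>{1..k - 1}.
             if lamb = sub_e nub j
             then (if interlaces k nub lam
                   then (\<Sum>m\<in>free k nub lam.
                          if nu = add_e lam m then slice_V q (slice d k) k nub lam j m else 0) +
                        (if nu = lam
                         then 1 - (\<Sum>m\<in>free k nub lam. slice_V q (slice d k) k nub lam j m)
                         else 0)
                   else if interlaces k nub (add_e lam j) \<and> nu = add_e lam j then 1 else 0)
             else 0
      else 0)"

definition dyn :: "real \<Rightarrow> (nat \<Rightarrow> real) \<Rightarrow> nat \<Rightarrow> nat list fundamental \<Rightarrow> dynamics" where
  "dyn q a N d = \<lparr>jump_rate = W_of q a N d, push_prob = V_of q N d\<rparr>"


section \<open>Honest Markov processes\<close>

definition honest :: "nat \<Rightarrow> dynamics \<Rightarrow> bool" where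
  "honest N D \<longleftrightarrow>
     (\<forall>k\<in>{1..N}. \<forall>nub lam. interlaces k nub lam \<longrightarrow>
        (\<forall>m\<in>free k nub lam. 0 \<le> jump_rate D k lam (add_e lam m) nub) \<and>
        (\<forall>j\<in>{1..k - 1}. j + 1 \<in> free k nub lam \<longrightarrow>
           (\<forall>nu. 0 \<le> push_prob D k lam nu (sub_e nub j) nub)))"

end

theory Submission
  imports Defs
begin

text \<open>
  All conditions are local to one slice of levels \<open>k - 1, k\<close> with \<open>k \<ge> 2\<close>. The key identity is
  \<open>S\<^sub>1 + \<dots> + S\<^sub>j - T\<^sub>1 - \<dots> - T\<^bsub>j-1\<^esub> = T\<^sub>j + z\<^sub>j\<close> with \<open>z\<^sub>j = q powi (nub j - lam (j + 1))\<close>; hence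
  \<open>r\<^sub>j = 1 + z\<^sub>j / T\<^sub>j > 1\<close> for \<open>j < h\<close>, whereas \<open>r\<^sub>j = 1 - (1 - z\<^sub>j) / T\<^sub>j \<in> [0, 1]\<close> for \<open>j \<ge> h\<close>, as
  \<open>T\<^sub>j \<ge> 1 - z\<^sub>j\<close>. So \<open>RSK h\<close> is honest exactly for \<open>h = 1\<close>. The rule \<open>R 1\<close> is honest because
  \<open>S\<^sub>1 \<ge> T\<^sub>1\<close>. The negative rates of \<open>R h\<close> for \<open>h \<ge> 2\<close> and of \<open>L h\<close> are all seen on one family of
  signatures: \<open>1\<close> before position \<open>h\<close>, \<open>0\<close> at \<open>h\<close> and \<open>-2\<close> after it.
\<close>

section \<open>Signs and bounds of the coefficients \<open>S\<close> and \<open>T\<close>\<close>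

lemma powi_le_one:
  fixes q :: real
  assumes "0 < q" "q < 1" "0 \<le> n"
  shows "q powi n \<le> 1"
  using assms power_int_decreasing[of 0 n q] by simp

lemma powi_less_one:
  fixes q :: real
  assumes "0 < q" "q < 1" "0 < n"
  shows "q powi n < 1"
  using assms power_int_strict_decreasing[of 0 n q] by simp

lemma S_coef_nonneg:
  assumes q: "0 < q" "q < 1" and il: "interlaces k nub lam" and m: "m \<in> {1..k}"
  shows "0 \<le> S_coef q k nub lam m"
proof -
  have 1: "q powi (nub (m - 1) - lam m) \<le> 1" if "m \<noteq> 1"
  proof -
    have "m - 1 \<in> {1..k - 1}" "m - 1 + 1 = m"
      using m that by auto
    then have "lam m \<le> nub (m - 1)"
      using il unfolding interlaces_def by metis
    then show ?thesis using m that q by (intro powi_le_one) auto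
  qed
  have 2: "q powi (lam m - lam (m + 1) + 1) \<le> 1" "q powi (lam m - nub m + 1) \<le> 1" if "m \<noteq> k"
  proof -
    have "lam (m + 1) \<le> nub m" "nub m \<le> lam m"
      using il m that by (auto simp: interlaces_def)
    then show "q powi (lam m - lam (m + 1) + 1) \<le> 1" "q powi (lam m - nub m + 1) \<le> 1"
      using q by (auto intro!: powi_le_one)
  qed
  show ?thesis
    using 1 2 by (auto simp: S_coef_def)
qed

text \<open>Here \<open>T_j = (1 - z) (1 - w) / (1 - y)\<close>, and
  \<open>lam j \<le> nub (j - 1)\<close> gives \<open>w \<le> y < 1\<close>, so the quotient
  \<open>(1 - w) / (1 - y)\<close> is at least \<open>1\<close>.\<close>

lemma T_coef_bounds:
  assumes q: "0 < q" "q < 1" and il: "interlaces k nub lam" and j: "j \<in> {1..k - 1}"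
  shows "1 - q powi (nub j - lam (j + 1)) \<le> T_coef q k nub lam j"
    and "lam (j + 1) < nub j \<Longrightarrow> 0 < T_coef q k nub lam j"
proof -
  define z where "z = q powi (nub j - lam (j + 1))"
  define y where "y = q powi (lam j - nub j + 1)"
  \<comment> \<open>The value \<open>0\<close> for \<open>j = 1\<close> encodes the infinite
    coordinate \<open>0\<close> of \<open>nub\<close>.\<close>
  define w where "w = (if j = 1 then 0 else q powi (nub (j - 1) - nub j + 1))"
  have b: "lam (j + 1) \<le> nub j" "nub j \<le> lam j"
    using il j by (auto simp: interlaces_def)
  have z1: "z \<le> 1" and y1: "y < 1"
    using b q by (auto simp: z_def y_def intro!: powi_le_one powi_less_one)
  have wy: "w \<le> y"
  proof (cases "j = 1")
    case True
    then show ?thesis using q by (simp add: w_def y_def)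
  next
    case False
    then have "j - 1 \<in> {1..k - 1}" "j - 1 + 1 = j"
      using j by auto
    then have "lam j \<le> nub (j - 1)"
      using il unfolding interlaces_def by metis
    then show ?thesis
      using False q b by (auto simp: w_def y_def intro!: power_int_decreasing)
  qed
  have T: "T_coef q k nub lam j = (1 - z) * ((1 - w) / (1 - y))"
    by (simp add: T_coef_def z_def y_def w_def)
  have f: "1 \<le> (1 - w) / (1 - y)"
    using wy y1 by simp
  show "1 - q powi (nub j - lam (j + 1)) \<le> T_coef q k nub lam j"
    using mult_left_mono[OF f, of "1 - z"] z1 unfolding T z_def[symmetric] by simp
  show "0 < T_coef q k nub lam j" if "lam (j + 1) < nub j"
  proof -
    have "z < 1"
      using that q by (auto simp: z_def intro!: powi_less_one)
    then show ?thesis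
      unfolding T using f by (intro mult_pos_pos) auto
  qed
qed

text \<open>Induction on \<open>j\<close>: the claim telescopes to \<open>S_1 = T_1 + z_1\<close>
  and \<open>z_(j-1) + S_j = T_j + z_j\<close>. The bound \<open>j < k\<close> keeps all factors of
  \<open>S_j\<close> involving \<open>lam (j + 1)\<close> and \<open>nub j\<close> present.\<close>

lemma sum_S_minus_sum_T:
  assumes q: "0 < q" "q < 1" and il: "interlaces k nub lam" and "j \<in> {1..k - 1}"
  shows "(\<Sum>i\<in>{1..j}. S_coef q k nub lam i) - (\<Sum>i\<in>{1..<j}. T_coef q k nub lam i) =
    T_coef q k nub lam j + q powi (nub j - lam (j + 1))"
proof -
  have "1 \<le> j" "j < k"
    using assms(4) by auto
  then show ?thesis
  proof (induction j rule: dec_induct)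
    case base
    define y where "y = q powi (lam 1 - nub 1 + 1)"
    define z where "z = q powi (nub 1 - lam (Suc 1))"
    have "nub 1 \<le> lam 1"
      using il base by (auto simp: interlaces_def)
    then have "y < 1"
      using q by (auto simp: y_def intro!: powi_less_one)
    moreover have "q powi (lam 1 - lam (Suc 1) + 1) = y * z"
      using q by (simp add: y_def z_def algebra_simps flip: power_int_add)
    ultimately have "S_coef q k nub lam 1 = T_coef q k nub lam 1 + z"
      using base by (simp add: S_coef_def T_coef_def flip: y_def[unfolded One_nat_def] z_def[unfolded One_nat_def])
        (simp add: field_simps)
    then show ?case
      by (simp add: z_def)
  next
    case (step n)
    define x where "x = q powi (nub n - lam (Suc n))"
    define y where "y = q powi (lam (Suc n) - nub (Suc n) + 1)"
    define z where "z = q powi (nub (Suc n) - lam (Suc (Suc n)))"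
    have "nub (Suc n) \<le> lam (Suc n)"
      using il step by (auto simp: interlaces_def)
    then have "y < 1"
      using q by (auto simp: y_def intro!: powi_less_one)
    moreover have "q powi (lam (Suc n) - lam (Suc (Suc n)) + 1) = y * z"
      "q powi (nub n - nub (Suc n) + 1) = x * y"
      using q by (simp_all add: x_def y_def z_def algebra_simps flip: power_int_add)
    \<comment> \<open>Over the denominator \<open>1 - y\<close>, both sides have the numerator
      \<open>1 - x y - y z + x y z\<close>, which is symmetric in \<open>x\<close> and
      \<open>z\<close>.\<close>
    ultimately have "x + S_coef q k nub lam (Suc n) = T_coef q k nub lam (Suc n) + z"
      using step by (simp add: S_coef_def T_coef_def flip: x_def y_def z_def)
        (simp add: field_simps)
    then show ?case
      using step by (simp add: x_def z_def)
  qed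
qed

lemma r_coef_eq:
  assumes "0 < q" "q < 1" "interlaces k nub lam" "j \<in> {1..k - 1}"
  shows "r_coef q k h nub lam j =
    (T_coef q k nub lam j + q powi (nub j - lam (j + 1)) - of_bool (h \<le> j)) / T_coef q k nub lam j"
  using sum_S_minus_sum_T[OF assms] by (simp add: r_coef_def)

lemma T_1_le_S_1:
  assumes q: "0 < q" "q < 1" and il: "interlaces k nub lam" and k: "2 \<le> k"
  shows "T_coef q k nub lam 1 \<le> S_coef q k nub lam 1"
proof -
  have "S_coef q k nub lam 1 = T_coef q k nub lam 1 + q powi (nub 1 - lam (1 + 1))"
    using sum_S_minus_sum_T[OF q il, of 1] k by simp
  then show ?thesis
    using q by simp
qed

section \<open>Free coordinates and reduction of honesty to single slices\<close>

lemma finite_free [simp]: "finite (free k nub lam)"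
  by (simp add: free_def)

lemma xi_in_free:
  assumes "1 \<le> k" "1 \<le> i"
  shows "xi k nub lam i \<in> free k nub lam" "xi k nub lam i \<le> i"
proof -
  have "1 \<in> {j \<in> free k nub lam. j \<le> i}"
    using assms by (simp add: free_def)
  then have "xi k nub lam i \<in> {j \<in> free k nub lam. j \<le> i}"
    unfolding xi_def by (intro Max_in) auto
  then show "xi k nub lam i \<in> free k nub lam" "xi k nub lam i \<le> i"
    by auto
qed

lemma xi_eq_self:
  assumes "i \<in> free k nub lam"
  shows "xi k nub lam i = i"
  unfolding xi_def using assms by (intro Max_eqI) auto

text \<open>The bound on the sum is the nonnegativity of the probability of staying put.\<close>

definition slice_honest :: "real \<Rightarrow> real \<Rightarrow> nat fundamental \<Rightarrow> nat \<Rightarrow> bool" where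
  "slice_honest q a f k \<longleftrightarrow>
     (\<forall>nub lam. interlaces k nub lam \<longrightarrow>
        (\<forall>m\<in>free k nub lam. 0 \<le> slice_W q a f k nub lam m) \<and>
        (\<forall>j\<in>{1..k - 1}. j + 1 \<in> free k nub lam \<longrightarrow>
           (\<forall>m\<in>free k nub lam. 0 \<le> slice_V q f k nub lam j m) \<and>
           (\<Sum>m\<in>free k nub lam. slice_V q f k nub lam j m) \<le> 1))"

lemma add_e_eq_iff [simp]: "add_e lam m = add_e lam n \<longleftrightarrow> m = n"
  by (auto simp: add_e_def fun_upd_def fun_eq_iff split: if_splits)

lemma add_e_neq [simp]: "add_e lam m \<noteq> lam" "lam \<noteq> add_e lam m"
  by (auto simp: add_e_def fun_upd_def fun_eq_iff)

lemma sub_e_eq_iff [simp]: "sub_e lam m = sub_e lam n \<longleftrightarrow> m = n"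
  by (auto simp: sub_e_def fun_upd_def fun_eq_iff split: if_splits)

text \<open>Freeness of \<open>j + 1\<close> is the strict inequality
  \<open>lam (j + 1) < nub j\<close>, which leaves room to lower \<open>nub j\<close> by one. This
  ensures that \<open>V_of\<close> does not take its default value \<open>0\<close> on the moves
  tested by \<open>honest\<close>.\<close>

lemma interlaces_sub_e:
  assumes il: "interlaces k nub lam" and j: "j \<in> {1..k - 1}" and f: "j + 1 \<in> free k nub lam"
  shows "interlaces k (sub_e nub j) lam"
proof -
  have lt: "lam (j + 1) < nub j"
    using j f by (auto simp: free_def)
  have "nub (j + 1) \<le> nub j - 1" if "j + 1 < k"
  proof -
    have "nub (j + 1) \<le> lam (j + 1)"
      using il that by (simp add: interlaces_def)
    then show ?thesis using lt by simp
  qed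
  moreover have "nub \<in> GT (k - 1)"
    using il by (simp add: interlaces_def)
  ultimately have "sub_e nub j \<in> GT (k - 1)"
    using j by (fastforce simp: GT_def sub_e_def)
  moreover have "\<forall>i\<in>{1..k - 1}. lam (i + 1) \<le> sub_e nub j i \<and> sub_e nub j i \<le> lam i"
    using il j lt by (force simp: interlaces_def sub_e_def)
  ultimately show ?thesis
    using il by (simp add: interlaces_def)
qed

lemma W_of_add_e:
  assumes "k \<in> {1..N}" "interlaces k nub lam" "m \<in> free k nub lam"
  shows "W_of q a N d k lam (add_e lam m) nub =
    (if k = 1 then a 1 else slice_W q (a k) (slice d k) k nub lam m)"
  using assms by (simp add: W_of_def)

lemma V_of_sub_e:
  assumes "k \<in> {2..N}" "interlaces k nub lam" "j \<in> {1..k - 1}" "j + 1 \<in> free k nub lam"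
  shows "V_of q N d k lam nu (sub_e nub j) nub =
    (\<Sum>m\<in>free k nub lam. if nu = add_e lam m then slice_V q (slice d k) k nub lam j m else 0) +
    (if nu = lam then 1 - (\<Sum>m\<in>free k nub lam. slice_V q (slice d k) k nub lam j m) else 0)"
  using assms interlaces_sub_e[OF assms(2-4)] by (simp add: V_of_def)

text \<open>The targets \<open>add_e lam m\<close> and \<open>lam\<close> are pairwise distinct, so
  each choice of \<open>nu\<close> isolates one probability.\<close>

lemma V_of_nonneg_iff:
  assumes "k \<in> {2..N}" "interlaces k nub lam" "j \<in> {1..k - 1}" "j + 1 \<in> free k nub lam"
  shows "(\<forall>nu. 0 \<le> V_of q N d k lam nu (sub_e nub j) nub) \<longleftrightarrow>
    (\<forall>m\<in>free k nub lam. 0 \<le> slice_V q (slice d k) k nub lam j m) \<and>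
    (\<Sum>m\<in>free k nub lam. slice_V q (slice d k) k nub lam j m) \<le> 1"
    (is "?l \<longleftrightarrow> ?r")
proof
  assume l: ?l
  have "0 \<le> slice_V q (slice d k) k nub lam j m" if "m \<in> free k nub lam" for m
    using l[rule_format, of "add_e lam m"] that by (simp add: V_of_sub_e[OF assms])
  moreover have "(\<Sum>m\<in>free k nub lam. slice_V q (slice d k) k nub lam j m) \<le> 1"
    using l[rule_format, of lam] by (simp add: V_of_sub_e[OF assms])
  ultimately show ?r by blast
next
  assume ?r
  then show ?l
    by (auto simp: V_of_sub_e[OF assms] intro!: add_nonneg_nonneg sum_nonneg)
qed

text \<open>Level \<open>1\<close> contributes only the positive rate \<open>a 1\<close> and no
  triggered moves.\<close>

lemma honest_dyn_iff:
  assumes "1 \<le> N" "0 < a 1"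
  shows "honest N (dyn q a N d) \<longleftrightarrow> (\<forall>k\<in>{2..N}. slice_honest q (a k) (slice d k) k)"
proof -
  have split: "{1..N} = insert 1 {2..N}"
    using assms by auto
  have "honest N (dyn q a N d) \<longleftrightarrow> (\<forall>k\<in>{2..N}. \<forall>nub lam. interlaces k nub lam \<longrightarrow>
        (\<forall>m\<in>free k nub lam. 0 \<le> W_of q a N d k lam (add_e lam m) nub) \<and>
        (\<forall>j\<in>{1..k - 1}. j + 1 \<in> free k nub lam \<longrightarrow>
           (\<forall>nu. 0 \<le> V_of q N d k lam nu (sub_e nub j) nub)))"
    unfolding honest_def split using assms by (simp add: dyn_def W_of_add_e)
  also have "\<dots> \<longleftrightarrow> (\<forall>k\<in>{2..N}. slice_honest q (a k) (slice d k) k)"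
    unfolding slice_honest_def
    by (intro ball_cong refl all_cong imp_cong conj_cong) (auto simp: W_of_add_e V_of_nonneg_iff)
  finally show ?thesis .
qed

section \<open>The honest slice rules\<close>

lemma slice_honest_PB:
  assumes "0 < q" "q < 1" "0 < a"
  shows "slice_honest q a PB k"
proof -
  have "0 \<le> a * S_coef q k nub lam m" if "interlaces k nub lam" "m \<in> free k nub lam" for nub lam m
    using assms S_coef_nonneg[of q k nub lam m] that by (simp add: free_def)
  then show ?thesis
    by (simp add: slice_honest_def)
qed

lemma slice_honest_R_1:
  assumes q: "0 < q" "q < 1" and a: "0 < a" and k: "2 \<le> k"
  shows "slice_honest q a (R 1) k"
proof -
  \<comment> \<open>Coordinate \<open>1\<close> is always free, so only its rate is reduced, and
    \<open>S_1 - T_1 \<ge> 0\<close> suffices.\<close>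
  have x: "xi k nub lam 1 = 1" for nub lam
    using k by (intro xi_eq_self) (simp add: free_def)
  have "0 \<le> S_coef q k nub lam m - of_bool (m = 1) * T_coef q k nub lam 1"
    if "interlaces k nub lam" "m \<in> free k nub lam" for nub lam m
    using T_1_le_S_1[OF q that(1) k] S_coef_nonneg[OF q that(1), of m] that(2)
    by (cases "m = 1") (auto simp: free_def)
  moreover have "(\<Sum>m\<in>free k nub lam. slice_V q (R 1) k nub lam j m) \<le> 1" for nub lam j
    unfolding slice_V.simps x by (cases "j = 1") (simp_all add: of_bool_def)
  ultimately show ?thesis
    using a by (auto simp: slice_honest_def x simp del: One_nat_def)
qed

lemma slice_honest_RSK_1:
  assumes q: "0 < q" "q < 1" and a: "0 < a" and k: "2 \<le> k"
  shows "slice_honest q a (RSK 1) k"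
proof -
  have "(\<forall>m\<in>free k nub lam. 0 \<le> slice_V q (RSK 1) k nub lam j m) \<and>
        (\<Sum>m\<in>free k nub lam. slice_V q (RSK 1) k nub lam j m) \<le> 1"
    if il: "interlaces k nub lam" and j: "j \<in> {1..k - 1}" and f: "j + 1 \<in> free k nub lam" for nub lam j
  proof -
    have "lam (j + 1) < nub j"
      using f j by (simp add: free_def)
    then have T: "0 < T_coef q k nub lam j" "1 - q powi (nub j - lam (j + 1)) \<le> T_coef q k nub lam j"
      and z: "q powi (nub j - lam (j + 1)) \<le> 1"
      using T_coef_bounds[OF q il j] q by (auto intro!: powi_le_one)
    define r where "r = r_coef q k 1 nub lam j"
    have r: "0 \<le> r" "r \<le> 1"
      using T z j by (simp_all add: r_def r_coef_eq[OF q il j])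
    \<comment> \<open>Both \<open>xi k nub lam j\<close> and \<open>j + 1\<close> are free, so
      neither weight is lost and \<open>r + (1 - r)\<close> remains.\<close>
    have "(\<Sum>m\<in>free k nub lam. r * of_bool (m = xi k nub lam j) + (1 - r) * of_bool (m = j + 1)) = 1"
      using f xi_in_free(1)[of k j nub lam] k j
      by (simp add: sum.distrib of_bool_def flip: sum_distrib_left)
    then show ?thesis
      using r unfolding slice_V.simps r_def[symmetric] by simp
  qed
  then show ?thesis
    using a by (simp add: slice_honest_def)
qed

section \<open>Violations of honesty for the other slice rules\<close>

definition drop_sig :: "nat \<Rightarrow> nat \<Rightarrow> signature" where
  "drop_sig h k i = (if 1 \<le> i \<and> i < h then 1 else if h < i \<and> i \<le> k then -2 else 0)"

lemma interlaces_drop_sig: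
  assumes "1 \<le> h" "h < k"
  shows "interlaces k (drop_sig h (k - 1)) (drop_sig h k)"
  using assms by (auto simp: interlaces_def GT_def drop_sig_def)

lemma free_drop_sig:
  assumes "1 \<le> h" "h < k"
  shows "h \<in> free k (drop_sig h (k - 1)) (drop_sig h k)"
    and "h + 1 \<in> free k (drop_sig h (k - 1)) (drop_sig h k)"
  using assms by (auto simp: free_def drop_sig_def)

text \<open>The drops of sizes \<open>1\<close> and \<open>2\<close> around position
  \<open>h\<close> give \<open>z_(h-1) = q\<close> (for \<open>h \<ge> 2\<close>) and
  \<open>z_h = q\<^sup>2\<close>, so telescoping predicts
  \<open>S_h - T_h = z_h - z_(h-1) < 0\<close>. Moreover \<open>S_(h+1) = 1 - z_h\<close>, and the
  lower bound \<open>1 - z_h\<close> for \<open>T_h\<close> is strict here.\<close>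

lemma drop_sig_coefs:
  assumes q: "0 < q" "q < 1" and h: "1 \<le> h" "h < k"
  defines "nub \<equiv> drop_sig h (k - 1)" and "lam \<equiv> drop_sig h k"
  shows "2 \<le> h \<Longrightarrow> S_coef q k nub lam h < T_coef q k nub lam h"
    and "S_coef q k nub lam (h + 1) < T_coef q k nub lam h"
proof -
  have p: "q powi 2 = q\<^sup>2" "q powi 3 = q ^ 3"
    by (simp_all add: power_int_def)
  have q2: "q\<^sup>2 < 1"
    using q by (simp add: power_less_one_iff)
  show "S_coef q k nub lam h < T_coef q k nub lam h" if "2 \<le> h"
  proof -
    have "S_coef q k nub lam h = (1 - q) * (1 - q ^ 3) / (1 - q)"
      using h that by (auto simp: S_coef_def nub_def lam_def drop_sig_def p)
    moreover have "T_coef q k nub lam h = (1 - q\<^sup>2) * (1 - q\<^sup>2) / (1 - q)"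
      using h that by (auto simp: T_coef_def nub_def lam_def drop_sig_def p)
    moreover have "(1 - q\<^sup>2) * (1 - q\<^sup>2) = (1 - q ^ 3) * (1 - q) + q * (1 - q)\<^sup>2"
      by algebra
    ultimately have "S_coef q k nub lam h * (1 - q) < T_coef q k nub lam h * (1 - q)"
      using q by simp
    then show ?thesis
      using q by simp
  qed
  \<comment> \<open>If \<open>h + 1 < k\<close>, the two remaining factors both equal
    \<open>1 - q\<close> and cancel; if \<open>h + 1 = k\<close>, they are absent.\<close>
  have "S_coef q k nub lam (h + 1) = 1 - q\<^sup>2"
    using h q by (auto simp: S_coef_def nub_def lam_def drop_sig_def p)
  moreover have "T_coef q k nub lam h = (1 - q\<^sup>2) * ((if h = 1 then 1 else 1 - q\<^sup>2) / (1 - q))"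
    using h by (auto simp: T_coef_def nub_def lam_def drop_sig_def p)
  moreover have "1 < (if h = 1 then 1 else 1 - q\<^sup>2) / (1 - q)"
    using q by (simp add: power2_eq_square)
  ultimately show "S_coef q k nub lam (h + 1) < T_coef q k nub lam h"
    using q2 mult_strict_left_mono[of 1 _ "1 - q\<^sup>2"] by (metis diff_gt_0_iff_gt mult.right_neutral)
qed

text \<open>As \<open>h\<close> is free, \<open>xi\<close> fixes it, and the jump rate of coordinate
  \<open>h\<close> is \<open>a (S_h - T_h) < 0\<close>.\<close>

lemma not_slice_honest_R:
  assumes q: "0 < q" "q < 1" and a: "0 < a" and h: "2 \<le> h" "h < k"
  shows "\<not> slice_honest q a (R h) k"
proof
  let ?nub = "drop_sig h (k - 1)" and ?lam = "drop_sig h k"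
  assume "slice_honest q a (R h) k"
  then have "0 \<le> slice_W q a (R h) k ?nub ?lam h"
    using h by (simp only: slice_honest_def interlaces_drop_sig free_drop_sig)
  moreover have "xi k ?nub ?lam h = h"
    using h by (intro xi_eq_self free_drop_sig) auto
  ultimately have "T_coef q k ?nub ?lam h \<le> S_coef q k ?nub ?lam h"
    using a by (simp add: zero_le_mult_iff)
  then show False
    using drop_sig_coefs(1)[OF q, of h k] h by simp
qed

lemma not_slice_honest_L:
  assumes q: "0 < q" "q < 1" and a: "0 < a" and h: "1 \<le> h" "h < k"
  shows "\<not> slice_honest q a (L h) k"
proof
  let ?nub = "drop_sig h (k - 1)" and ?lam = "drop_sig h k"
  assume "slice_honest q a (L h) k"
  then have "0 \<le> slice_W q a (L h) k ?nub ?lam (h + 1)"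
    using h by (simp only: slice_honest_def interlaces_drop_sig free_drop_sig)
  then have "T_coef q k ?nub ?lam h \<le> S_coef q k ?nub ?lam (h + 1)"
    using a by (simp add: zero_le_mult_iff)
  then show False
    using drop_sig_coefs(2)[OF q h] by simp
qed

text \<open>The witness makes coordinate \<open>2\<close> free. Since \<open>1 < h\<close>, the
  indicator in \<open>r_1\<close> vanishes, so \<open>r_1 = 1 + z_1 / T_1 > 1\<close> and coordinate
  \<open>2\<close> is pushed with the negative probability \<open>1 - r_1\<close>.\<close>

lemma not_slice_honest_RSK:
  assumes q: "0 < q" "q < 1" and h: "2 \<le> h" and k: "2 \<le> k"
  shows "\<not> slice_honest q a (RSK h) k"
proof
  let ?nub = "drop_sig 1 (k - 1)" and ?lam = "drop_sig 1 k"
  assume honest: "slice_honest q a (RSK h) k"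
  have il: "interlaces k ?nub ?lam" and f: "1 + 1 \<in> free k ?nub ?lam" and j: "1 \<in> {1..k - 1}"
    using k interlaces_drop_sig[of 1 k] free_drop_sig(2)[of 1 k] by simp_all
  have "0 \<le> slice_V q (RSK h) k ?nub ?lam 1 (1 + 1)"
    using honest il f j by (simp only: slice_honest_def)
  moreover have "xi k ?nub ?lam 1 = 1"
    using k by (intro xi_eq_self) (simp add: free_def)
  ultimately have "r_coef q k h ?nub ?lam 1 \<le> 1"
    by simp
  moreover have "0 < T_coef q k ?nub ?lam 1"
    using f by (intro T_coef_bounds(2)[OF q il j]) (simp add: free_def)
  ultimately show False
    using q h unfolding r_coef_eq[OF q il j]
    by (simp add: not_le[THEN iffD2, OF zero_less_power_int])
qed

section \<open>Assembling the slices into the classification\<close>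

lemma honest_iff_listed:
  assumes q: "0 < q" "q < 1" and N: "2 \<le> N" and a: "\<forall>k\<in>{1..N}. 0 < a k"
    and d: "is_fundamental N d"
  shows "honest N (dyn q a N d) \<longleftrightarrow> d \<in> {PB, RSK (replicate N 1), R (replicate (N - 1) 1)}"
proof -
  have iff: "honest N (dyn q a N d) \<longleftrightarrow> (\<forall>k\<in>{2..N}. slice_honest q (a k) (slice d k) k)"
    using N a by (intro honest_dyn_iff) auto
  show ?thesis
  proof (cases d)
    case PB
    then show ?thesis
      unfolding iff using q a by (simp add: slice_honest_PB)
  next
    case (RSK h)
    then have len: "length h = N" and bd: "\<And>k. k \<in> {1..N} \<Longrightarrow> 1 \<le> h ! (k - 1) \<and> h ! (k - 1) \<le> k"
      using d by auto
    have "slice_honest q (a k) (RSK (h ! (k - 1))) k \<longleftrightarrow> h ! (k - 1) = 1" if "k \<in> {2..N}" for k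
      using that bd[of k] slice_honest_RSK_1[OF q, of "a k" k]
        not_slice_honest_RSK[OF q, of "h ! (k - 1)" k "a k"] a
      by (cases "h ! (k - 1) = 1") auto
    then have "honest N (dyn q a N d) \<longleftrightarrow> (\<forall>k\<in>{2..N}. h ! (k - 1) = 1)"
      unfolding iff by (simp add: RSK)
    also have "\<dots> \<longleftrightarrow> (\<forall>i<N. h ! i = 1)"
    proof (intro iffI allI ballI impI)
      fix i assume "\<forall>k\<in>{2..N}. h ! (k - 1) = 1" "i < N"
      \<comment> \<open>No slice tests entry \<open>0\<close>; it is \<open>1\<close> because level
        \<open>1\<close> admits only \<open>h = 1\<close>.\<close>
      then show "h ! i = 1"
        using bd[of 1] by (cases "i = 0") (auto dest: bspec[of _ _ "i + 1"])
    qed auto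
    also have "\<dots> \<longleftrightarrow> h = replicate N 1"
      using len by (auto simp: list_eq_iff_nth_eq)
    finally show ?thesis by (simp add: RSK)
  next
    case (R h)
    then have len: "length h = N - 1"
      and bd: "\<And>k. k \<in> {1..N - 1} \<Longrightarrow> 1 \<le> h ! (k - 1) \<and> h ! (k - 1) \<le> k"
      using d by auto
    have "slice_honest q (a k) (R (h ! (k - 2))) k \<longleftrightarrow> h ! (k - 2) = 1" if k: "k \<in> {2..N}" for k
    proof (cases "h ! (k - 2) = 1")
      case True
      then show ?thesis
        using slice_honest_R_1[OF q, of "a k" k] k a by simp
    next
      case False
      \<comment> \<open>The entry used on levels \<open>k - 1, k\<close> has index
        \<open>k - 1\<close> in the vector, hence the bound
        \<open>h ! (k - 2) \<le> k - 1\<close>.\<close>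
      have "k - 1 - 1 = k - 2" "k - 1 \<in> {1..N - 1}" "0 < a k"
        using k a by auto
      with bd[of "k - 1"] False k have "2 \<le> h ! (k - 2)" "h ! (k - 2) < k"
        by auto
      then have "\<not> slice_honest q (a k) (R (h ! (k - 2))) k"
        using \<open>0 < a k\<close> by (intro not_slice_honest_R[OF q])
      then show ?thesis
        using False by blast
    qed
    then have "honest N (dyn q a N d) \<longleftrightarrow> (\<forall>k\<in>{2..N}. h ! (k - 2) = 1)"
      unfolding iff by (simp add: R)
    also have "\<dots> \<longleftrightarrow> (\<forall>i<N - 1. h ! i = 1)"
    proof (intro iffI allI ballI impI)
      fix i assume "\<forall>k\<in>{2..N}. h ! (k - 2) = 1" "i < N - 1"
      then show "h ! i = 1"
        by (auto dest: bspec[of _ _ "i + 2"])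
    qed auto
    also have "\<dots> \<longleftrightarrow> h = replicate (N - 1) 1"
      using len by (auto simp: list_eq_iff_nth_eq)
    finally show ?thesis by (simp add: R)
  next
    case (L h)
    \<comment> \<open>The slice of levels \<open>1, 2\<close> exists as \<open>N \<ge> 2\<close>,
      admits only \<open>L 1\<close>, and already fails.\<close>
    then have "1 \<le> h ! 0 \<and> h ! 0 < 2"
      using d N by (auto dest!: bspec[of _ _ 1])
    then have "\<not> slice_honest q (a 2) (slice d 2) 2"
      using a N by (simp add: L not_slice_honest_L[OF q])
    then show ?thesis
      unfolding iff using N by (auto simp: L intro!: bexI[of _ 2])
  qed
qed

text \<open>The rate at level \<open>1\<close> ignores the rule, and there is no level in
  \<open>{2..1}\<close> to be pushed.\<close>

lemma dyn_depth_1: "dyn q a 1 d = dyn q a 1 d'"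
  by (auto simp: dyn_def W_of_def V_of_def fun_eq_iff intro!: sum.cong)

text \<open>At depth \<open>1\<close> the name \<open>L []\<close> is fundamental but not in
  \<open>listed\<close>, although it denotes the same dynamics; the second disjunct therefore
  compares dynamics instead of names.\<close>

theorem proposition8p2:
  fixes q :: real and a :: "nat \<Rightarrow> real" and N :: nat
  assumes "0 < q" and "q < 1"
    and "1 \<le> N"
    and "\<forall>k\<in>{1..N}. 0 < a k"
  defines "listed \<equiv> {PB, RSK (replicate N 1), R (replicate (N - 1) 1)}"
  shows "(\<forall>d. is_fundamental N d \<longrightarrow>
            (honest N (dyn q a N d) \<longleftrightarrow>
               d \<in> listed \<or> (N = 1 \<and> dyn q a N d \<in> dyn q a N ` listed))) \<and>
         (N = 1 \<longrightarrow> (\<forall>d d'. is_fundamental N d \<longrightarrow> is_fundamental N d' \<longrightarrow>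
            dyn q a N d = dyn q a N d'))"
proof (cases "N = 1")
  case True
  \<comment> \<open>With no slices, the criterion of \<open>honest_dyn_iff\<close> is
    vacuous.\<close>
  have "honest N (dyn q a N d)" for d
    using True assms by (subst honest_dyn_iff) auto
  moreover have "dyn q a N d \<in> dyn q a N ` listed" for d
    using dyn_depth_1[of q a d PB] True by (auto simp: listed_def)
  ultimately show ?thesis
    using True dyn_depth_1 by metis
next
  case False
  then show ?thesis
    using honest_iff_listed[OF assms(1,2) _ assms(4)] assms(3) by (simp add: listed_def)
qed

end
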